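(* Let $n,T\ge1$ and $0\le K<T$ be integers, and let real numbers $r_{jt}$ ($j=1,\ldots,n$, $t=1,\ldots,T$) and $\mu_0$ be given. Let $\alpha\ge 0$ be large enough that $a_{jt}:=\frac{1}{T-K}(r_{jt}+\alpha)>0$ for all $j,t$ and $\beta:=\mu_0+\alpha>0$. If $S\subseteq\{1,\ldots,T\}$ is a critical set, then the inequalities $$\sum_{t\in S}\tilde{x}_{jt}\le T-K-1,\qquad j=1,\ldots,n,$$ are valid for Problem (P$_{\tilde x}$), i.e. they are satisfied by every feasible solution $\tilde x=(\tilde x_{jt})$ of Problem (P$_{\tilde x}$).
   Context: A set $S\subseteq\{1,\ldots,T\}$ is called critical if for every $R\subseteq S$ with $|R|=T-K$ one has $\sum_{t\in R}\sum_{j=1}^n a_{jt}<\beta$. Problem (P$_{\tilde x}$), in the variables $\tilde x=(\tilde x_{jt})_{j=1,\ldots,n,\ t=1,\ldots,T}$, is: minimize $$\tilde V(\tilde x)=\sum_{t=1}^T q_t\Big(\sum_{j=1}^n r_{jt}\tilde x_{jt}\Big)^2-\Big(\sum_{t=1}^T\sum_{j=1}^n q_t r_{jt}\tilde x_{jt}\Big)^2,\qquad q_t=\frac1{T-K},$$ subject to - $\sum_{t=1}^T\sum_{j=1}^n a_{jt}\tilde x_{jt}\ge\beta$; - $\big|\{t\in\{1,\ldots,T\}:\tilde x_{jt}>0\text{ for some }j\in\{1,\ldots,n\}\}\big|=T-K$; - $\sum_{j=1}^n\tilde x_{jt}=1$ for every $t\in\{1,\ldots,T\}$ such that $\tilde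 x_{jt}>0$ for some $j$; - $\tilde x_{jt}=\tilde x_{jt'}$ for all $j\in\{1,\ldots,n\}$ and $t,t'\in\{1,\ldots,T\}$ with $\tilde x_{jt},\tilde x_{jt'}>0$; - $0\le\tilde x_{jt}\le1$ for all $j,t$. *)

theory Defs
  imports Complex_Main
begin

text \<open>
  Assets are indexed by \<open>{1..n}\<close> and scenarios by \<open>{1..T}\<close>; a decision \<open>x\<close>
  is read as the array \<open>x j t\<close> over these index sets, and its values outside them are irrelevant.
  The truncated difference \<open>T - K\<close> on natural numbers is only meant for \<open>K < T\<close>.
\<close>

record 'x min_problem =
  objective :: "'x \<Rightarrow> real"
  feasible_set :: "'x set"

definition valid_ineq :: "'x min_problem \<Rightarrow> ('x \<Rightarrow> real) \<Rightarrow> real \<Rightarrow> bool" where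
  "valid_ineq P g b \<longleftrightarrow> (\<forall>x\<in>feasible_set P. g x \<le> b)"

definition critical ::
  "nat \<Rightarrow> nat \<Rightarrow> nat \<Rightarrow> (nat \<Rightarrow> nat \<Rightarrow> real) \<Rightarrow> real \<Rightarrow> nat set \<Rightarrow> bool" where
  "critical n T K a \<beta> S \<longleftrightarrow>
     S \<subseteq> {1..T} \<and>
     (\<forall>R. R \<subseteq> S \<and> card R = T - K \<longrightarrow> (\<Sum>t\<in>R. \<Sum>j=1..n. a j t) < \<beta>)"

definition V_tilde ::
  "nat \<Rightarrow> nat \<Rightarrow> nat \<Rightarrow> (nat \<Rightarrow> nat \<Rightarrow> real) \<Rightarrow> (nat \<Rightarrow> nat \<Rightarrow> real) \<Rightarrow> real" where
  "V_tilde n T K r x =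
     (let q = (\<lambda>t::nat. 1 / real (T - K)) in
        (\<Sum>t=1..T. q t * (\<Sum>j=1..n. r j t * x j t)\<^sup>2)
        - (\<Sum>t=1..T. \<Sum>j=1..n. q t * r j t * x j t)\<^sup>2)"

definition feasible ::
  "nat \<Rightarrow> nat \<Rightarrow> nat \<Rightarrow> (nat \<Rightarrow> nat \<Rightarrow> real) \<Rightarrow> real \<Rightarrow> (nat \<Rightarrow> nat \<Rightarrow> real) \<Rightarrow> bool" where
  "feasible n T K a \<beta> x \<longleftrightarrow>
     (\<Sum>t=1..T. \<Sum>j=1..n. a j t * x j t) \<ge> \<beta> \<and>
     card {t\<in>{1..T}. \<exists>j\<in>{1..n}. x j t > 0} = T - K \<and>
     (\<forall>t\<in>{1..T}. (\<exists>j\<in>{1..n}. x j t > 0) \<longrightarrow> (\<Sum>j=1..n. x j t) = 1) \<and>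
     (\<forall>j\<in>{1..n}. \<forall>t\<in>{1..T}. \<forall>t'\<in>{1..T}. x j t > 0 \<and> x j t' > 0 \<longrightarrow> x j t = x j t') \<and>
     (\<forall>j\<in>{1..n}. \<forall>t\<in>{1..T}. 0 \<le> x j t \<and> x j t \<le> 1)"

definition problem_P ::
  "nat \<Rightarrow> nat \<Rightarrow> nat \<Rightarrow> (nat \<Rightarrow> nat \<Rightarrow> real) \<Rightarrow> (nat \<Rightarrow> nat \<Rightarrow> real) \<Rightarrow> real
    \<Rightarrow> (nat \<Rightarrow> nat \<Rightarrow> real) min_problem" where
  "problem_P n T K r a \<beta> =
     \<lparr>objective = V_tilde n T K r, feasible_set = {x. feasible n T K a \<beta> x}\<rparr>"

end

theory Submission
  imports Defs
begin

text \<open>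
  If all \<open>T - K\<close> active scenarios of a feasible \<open>x\<close> lay in the critical set \<open>S\<close>, they could be taken
  as the set \<open>R\<close> of criticality; since \<open>x \<le> 1\<close> and \<open>a > 0\<close>, the return constraint would fail. So at
  most \<open>T - K - 1\<close> scenarios of \<open>S\<close> are active, and each of them contributes at most 1 to the sum.
\<close>

text \<open>This is the set whose cardinality \<open>feasible\<close> fixes at \<open>T - K\<close>,
  so it qualifies in size as the \<open>R\<close> of \<open>critical\<close>.\<close>

definition active :: "nat \<Rightarrow> nat \<Rightarrow> (nat \<Rightarrow> nat \<Rightarrow> real) \<Rightarrow> nat set" where
  "active n T x = {t\<in>{1..T}. \<exists>j\<in>{1..n}. x j t > 0}"

lemma finite_active [simp]: "finite (active n T x)"
  by (simp add: active_def)

lemma feasible_bounds: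
  assumes "feasible n T K a \<beta> x" "j \<in> {1..n}" "t \<in> {1..T}"
  shows "0 \<le> x j t" "x j t \<le> 1"
  using assms unfolding feasible_def by blast+

lemma inactive_eq_0:
  assumes "feasible n T K a \<beta> x" "j \<in> {1..n}" "t \<in> {1..T}" "t \<notin> active n T x"
  shows "x j t = 0"
proof -
  have "\<not> 0 < x j t"
    using assms(2-4) unfolding active_def by blast
  then show ?thesis
    using feasible_bounds(1) [OF assms(1-3)] by simp
qed

text \<open>Dropping the inactive scenarios changes nothing, as \<open>x\<close> vanishes there; on
  the others, raising each \<open>x j t\<close> to 1 can only increase the sum when \<open>a\<close>
  is nonnegative.\<close>

lemma feasible_le_sum_active:
  assumes feas: "feasible n T K a \<beta> x"
    and nonneg: "\<forall>j\<in>{1..n}. \<forall>t\<in>{1..T}. a j t \<ge> 0"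
  shows "\<beta> \<le> (\<Sum>t\<in>active n T x. \<Sum>j=1..n. a j t)"
proof -
  have "\<beta> \<le> (\<Sum>t=1..T. \<Sum>j=1..n. a j t * x j t)"
    using feas unfolding feasible_def by blast
  also have "\<dots> = (\<Sum>t\<in>active n T x. \<Sum>j=1..n. a j t * x j t)"
  proof (rule sum.mono_neutral_right)
    show "\<forall>t\<in>{1..T} - active n T x. (\<Sum>j=1..n. a j t * x j t) = 0"
      using inactive_eq_0 [OF feas] by (intro ballI sum.neutral) (metis DiffE mult_zero_right)
  qed (simp, auto simp: active_def)
  also have "\<dots> \<le> (\<Sum>t\<in>active n T x. \<Sum>j=1..n. a j t)"
  proof (intro sum_mono mult_left_le)
    fix t j assume "t \<in> active n T x" and j: "j \<in> {1..n}"
    then have t: "t \<in> {1..T}"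
      unfolding active_def by blast
    show "x j t \<le> 1" "a j t \<ge> 0"
      using feasible_bounds(2) [OF feas j t] nonneg j t by blast+
  qed
  finally show ?thesis .
qed

lemma card_active_Int_critical:
  assumes "feasible n T K a \<beta> x" "critical n T K a \<beta> S"
    and "\<forall>j\<in>{1..n}. \<forall>t\<in>{1..T}. a j t \<ge> 0"
  shows "card (S \<inter> active n T x) < T - K"
proof -
  have card: "card (active n T x) = T - K"
    using assms(1) unfolding feasible_def active_def by blast
  \<comment> \<open>Otherwise \<open>active n T x\<close> is an admissible \<open>R\<close>. The
    reversed \<open>not_less\<close> turns the lower bound \<beta> into the negation of the strict
    inequality that criticality gives.\<close>
  have "\<not> active n T x \<subseteq> S"
    using assms(2) card feasible_le_sum_active [OF assms(1,3)]
    unfolding critical_def not_less[symmetric] by blast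
  then have "S \<inter> active n T x \<subset> active n T x"
    by blast
  then show ?thesis
    using psubset_card_mono [OF finite_active] card by metis
qed

text \<open>Activity does not refer to a single asset: an inactive scenario has weight 0 for every
  \<open>j\<close>, so one count bounds the sums of all assets.\<close>

lemma sum_le_card_active_Int:
  assumes feas: "feasible n T K a \<beta> x" and j: "j \<in> {1..n}" and S: "S \<subseteq> {1..T}"
  shows "(\<Sum>t\<in>S. x j t) \<le> real (card (S \<inter> active n T x))"
proof -
  have "(\<Sum>t\<in>S. x j t) = (\<Sum>t\<in>S \<inter> active n T x. x j t)"
  proof (rule sum.mono_neutral_right)
    show "finite S"
      using S finite_subset by blast
    show "\<forall>t\<in>S - S \<inter> active n T x. x j t = 0"
      using S inactive_eq_0 [OF feas j] by blast
  qed simp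
  \<comment> \<open>The factor 1 is the uniform bound on the summands, in the form
    \<open>sum_bounded_above\<close> expects.\<close>
  also have "\<dots> \<le> real (card (S \<inter> active n T x)) * 1"
    using feasible_bounds(2) [OF feas j] S by (intro sum_bounded_above) blast
  finally show ?thesis
    by simp
qed

theorem proposition3:
  fixes n T K :: nat
    and r a :: "nat \<Rightarrow> nat \<Rightarrow> real"
    and \<mu>\<^sub>0 \<alpha> \<beta> :: real
    and S :: "nat set"
  assumes "n \<ge> 1" and "T \<ge> 1" and "K < T"
    and "\<alpha> \<ge> 0"
    and "\<forall>j\<in>{1..n}. \<forall>t\<in>{1..T}. a j t = 1 / real (T - K) * (r j t + \<alpha>)"
    and "\<forall>j\<in>{1..n}. \<forall>t\<in>{1..T}. a j t > 0"
    and "\<beta> = \<mu>\<^sub>0 + \<alpha>" and "\<beta> > 0"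
    and "critical n T K a \<beta> S"
  shows "\<forall>j\<in>{1..n}. valid_ineq (problem_P n T K r a \<beta>) (\<lambda>x. \<Sum>t\<in>S. x j t) (real T - real K - 1)"
proof (intro ballI)
  fix j assume j: "j \<in> {1..n}"
  have S: "S \<subseteq> {1..T}"
    using \<open>critical n T K a \<beta> S\<close> by (simp add: critical_def)
  have nonneg: "\<forall>j\<in>{1..n}. \<forall>t\<in>{1..T}. a j t \<ge> 0"
    using assms(6) less_imp_le by blast
  \<comment> \<open>The strict inequality between naturals yields the -1. It also forces
    \<open>K < T\<close>, so the truncated \<open>T - K\<close> agrees with the real
    difference.\<close>
  have "(\<Sum>t\<in>S. x j t) \<le> real T - real K - 1" if feas: "feasible n T K a \<beta> x" for x
    using sum_le_card_active_Int [OF feas j S]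
      card_active_Int_critical [OF feas \<open>critical n T K a \<beta> S\<close> nonneg]
    by linarith
  then show "valid_ineq (problem_P n T K r a \<beta>) (\<lambda>x. \<Sum>t\<in>S. x j t) (real T - real K - 1)"
    by (simp add: valid_ineq_def problem_P_def)
qed

end
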